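(* For every integer $m\ge1$, the minimal output entropy of the EPOSIC channel $\Phi_{m,1,1}:End(P_{m-1})\to End(P_m)$ is $$S_{min}(\Phi_{m,1,1})=-\left[\frac{1}{m+1}\log_2\frac{1}{m+1}+\frac{m}{m+1}\log_2\frac{m}{m+1}\right].$$
   Context: Conventions: $\mathbb{N}=\{0,1,2,\dots\}$; all vector spaces are finite dimensional and complex. A state of a Hilbert space $H$ is a positive operator in $End(H)$ of trace one; a pure state is one of the form $ww^*$ with $w\in H$ a unit vector (here $uv^*$ denotes the operator $x\mapsto\langle v|x\rangle u$, the inner product being linear in the second variable). A quantum channel $\Phi:End(H)\to End(K)$ is a completely positive trace preserving linear map; operators $T_j:H\to K$ are Kraus operators of $\Phi$ if $\sum_j T_j^*T_j=I_H$ and $\Phi(A)=\sum_jT_jAT_j^*$ for all $A$. Minimal output entropy: $S_{min}(\Phi)=\min_{w\in H,\ \|w\|=1}S(\Phi(ww^* ))$, where $S(\varrho)=-\mathrm{tr}(\varrho\log_2\varrho)=-\sum_i\lambda_i\log_2\lambda_i$ with $\lambda_i$ the eigenvalues of $\varrho$ and $0\log_2 0=0$. EPOSIC channels: for $k\in\mathbb{N}$, $P_k$ is the $(k+1)$-dimensional space of homogeneous complex polynomials of degree $k$ in $x_1,x_2$, with inner product $\langle x_1^lx_2^{k-l},x_1^{l'}x_2^{k-l'}\rangle=l!(k-l)!\,\delta_{ll'}$ and orthonormal basis $f_l^k=\frac{1}{\sqrt{l!(k-l)!}}x_1^lx_2^{k-l}$, $0\le l\le k$. Let $m,n,h\in\mathbb{N}$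 with $0\le h\le\min\{m,n\}$ and $r=m+n-2h$. For $0\le i\le r$ put $B(i)=\{j\in\mathbb{Z}:\max\{0,-m+i+h\}\le j\le\min\{i+h,n\}\}$, and for $j\in B(i)$ put $l_{ij}=i-j+h$ and $$\varepsilon_i^j=\varepsilon_i^j(m,n,h)=\sum_{s=\max\{0,j-i,j+h-n\}}^{\min\{h,j,j+m-i-h\}}(-1)^s\sqrt{\frac{c_{m,n,h}\,r!\,m!\,n!}{\binom{r}{i}\binom{m}{i-j+h}\binom{n}{j}}}\;\frac{\binom{h}{s}\binom{n-h}{j-s}\binom{m-h}{i-j+s}}{(m-h)!},$$ where $c_{m,n,h}>0$ is the normalization constant for which $\sum_{j\in B(i)}(\varepsilon_i^j)^2=1$ for all $0\le i\le r$; explicitly $c_{m,n,h}=\frac{(m-h)!\,(r+1)}{h!\,(n-h)!\,(m+n-h+1)!}$. For $0\le j\le n$ define $T_j:P_r\to P_m$ linearly by $T_j(f_i^r)=\varepsilon_i^jf_{l_{ij}}^m$ if $j\in B(i)$ and $T_j(f_i^r)=0$ otherwise. The operators $T_0,\dots,T_n$ are Kraus operators (the EPOSIC Kraus operators) of a quantum channel $\Phi_{m,n,h}:End(P_r)\to End(P_m)$, $\Phi_{m,n,h}(A)=\sum_{j=0}^nT_jAT_j^*$, called the EPOSIC channel. Here it is used with $n=h=1$, so $r=m-1$. *)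

theory Defs
  imports
    Complex_Main
    "HOL-Library.Poly_Mapping"
    "HOL-Computational_Algebra.Polynomial"
    "Jordan_Normal_Form.Char_Poly"
begin

section \<open>The spaces of homogeneous polynomials\<close>

text \<open>A polynomial in two variables over the complex numbers is the finitely supported map sending
  an exponent pair \<open>(a, b)\<close> to the coefficient of \<open>x\<^sub>1\<^sup>a x\<^sub>2\<^sup>b\<close>.\<close>

type_synonym bipoly = "(nat \<times> nat) \<Rightarrow>\<^sub>0 complex"

definition hom_polys :: "nat \<Rightarrow> bipoly set" where
  "hom_polys k = {p. \<forall>a b. Poly_Mapping.lookup p (a, b) \<noteq> 0 \<longrightarrow> a + b = k}"

definition scale :: "complex \<Rightarrow> bipoly \<Rightarrow> bipoly" where
  "scale c p = Poly_Mapping.map (\<lambda>x. c * x) p"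

text \<open>The inner product of the space of degree \<open>k\<close>, linear in the second argument.\<close>

definition inner_hom :: "nat \<Rightarrow> bipoly \<Rightarrow> bipoly \<Rightarrow> complex" where
  "inner_hom k p q =
     (\<Sum>l\<le>k. fact l * fact (k - l) * cnj (Poly_Mapping.lookup p (l, k - l)) * Poly_Mapping.lookup q (l, k - l))"

definition basis_hom :: "nat \<Rightarrow> nat \<Rightarrow> bipoly" where
  "basis_hom k l =
     Poly_Mapping.single (l, k - l) (complex_of_real (1 / sqrt (fact l * fact (k - l))))"

definition unit_vectors :: "nat \<Rightarrow> bipoly set" where
  "unit_vectors k = {w \<in> hom_polys k. inner_hom k w w = 1}"

section \<open>Operators, entropy and minimal output entropy\<close>

text \<open>Operators between the spaces are HOL functions on polynomials, of which only the values on the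
  domain \<open>hom_polys k\<close> are meaningful.\<close>

type_synonym poly_op = "bipoly \<Rightarrow> bipoly"

definition rank_one :: "nat \<Rightarrow> bipoly \<Rightarrow> bipoly \<Rightarrow> poly_op" where
  "rank_one k u v = (\<lambda>x. scale (inner_hom k v x) u)"

definition is_adjoint :: "nat \<Rightarrow> nat \<Rightarrow> poly_op \<Rightarrow> poly_op \<Rightarrow> bool" where
  "is_adjoint r m T S \<longleftrightarrow>
     (\<forall>q \<in> hom_polys m. S q \<in> hom_polys r) \<and>
     (\<forall>p \<in> hom_polys r. \<forall>q \<in> hom_polys m. inner_hom m (T p) q = inner_hom r p (S q))"

text \<open>The adjoint of an operator from degree \<open>r\<close> to degree \<open>m\<close>; its values on
  \<open>hom_polys m\<close> are uniquely determined.\<close>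

definition adjoint_op :: "nat \<Rightarrow> nat \<Rightarrow> poly_op \<Rightarrow> poly_op" where
  "adjoint_op r m T = (SOME S. is_adjoint r m T S)"

definition op_matrix :: "nat \<Rightarrow> poly_op \<Rightarrow> complex mat" where
  "op_matrix k A =
     mat (k + 1) (k + 1) (\<lambda>(a, b). inner_hom k (basis_hom k a) (A (basis_hom k b)))"

text \<open>The eigenvalues are counted with algebraic multiplicity. They are real for states, so taking
  real parts loses nothing, and \<open>0 * log 2 0 = 0\<close> holds in HOL.\<close>

definition entropy :: "nat \<Rightarrow> poly_op \<Rightarrow> real" where
  "entropy k A = - (\<Sum>e \<in># proots (char_poly (op_matrix k A)). Re e * log 2 (Re e))"

definition output_entropies :: "nat \<Rightarrow> nat \<Rightarrow> (poly_op \<Rightarrow> poly_op) \<Rightarrow> real set" where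
  "output_entropies r m \<Phi> = {entropy m (\<Phi> (rank_one r w w)) | w. w \<in> unit_vectors r}"

text \<open>\<open>LEAST\<close> is the minimum of the set when that exists, and unspecified otherwise.\<close>

definition min_output_entropy :: "nat \<Rightarrow> nat \<Rightarrow> (poly_op \<Rightarrow> poly_op) \<Rightarrow> real" where
  "min_output_entropy r m \<Phi> = (LEAST s. s \<in> output_entropies r m \<Phi>)"

section \<open>EPOSIC channels\<close>

definition eposic_B :: "nat \<Rightarrow> nat \<Rightarrow> nat \<Rightarrow> nat \<Rightarrow> int set" where
  "eposic_B m n h i =
     {max 0 (- int m + int i + int h) .. min (int i + int h) (int n)}"

text \<open>The normalization constant, the one for which the squares of \<open>eposic_eps m n h i j\<close> sum to 1
  over \<open>j \<in> eposic_B m n h i\<close>, for every \<open>i \<le> m + n - 2 * h\<close>.\<close>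

definition eposic_c :: "nat \<Rightarrow> nat \<Rightarrow> nat \<Rightarrow> real" where
  "eposic_c m n h =
     fact (m - h) * real (m + n - 2 * h + 1) / (fact h * fact (n - h) * fact (m + n - h + 1))"

text \<open>Binomial coefficients with integer arguments. For \<open>h \<le> min m n\<close>, \<open>i \<le> m + n - 2 * h\<close> and
  \<open>j \<in> eposic_B m n h i\<close> all arguments below are nonnegative, so no truncation occurs.\<close>

definition binom :: "int \<Rightarrow> int \<Rightarrow> real" where
  "binom a b = real (nat a choose nat b)"

definition eposic_eps :: "nat \<Rightarrow> nat \<Rightarrow> nat \<Rightarrow> nat \<Rightarrow> int \<Rightarrow> real" where
  "eposic_eps m n h i j =
     (let r = m + n - 2 * h; M = int m; N = int n; H = int h; I = int i in
      \<Sum>s = max 0 (max (j - I) (j + H - N)) .. min H (min j (j + M - I - H)).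
        (-1) ^ nat s
        * sqrt (eposic_c m n h * fact r * fact m * fact n
                / (binom (int r) I * binom M (I - j + H) * binom N j))
        * (binom H s * binom (N - H) (j - s) * binom (M - H) (I - j + s) / fact (m - h)))"

definition eposic_kraus :: "nat \<Rightarrow> nat \<Rightarrow> nat \<Rightarrow> nat \<Rightarrow> poly_op" where
  "eposic_kraus m n h j p =
     (let r = m + n - 2 * h in
      \<Sum>i\<le>r. scale (inner_hom r (basis_hom r i) p)
        (if int j \<in> eposic_B m n h i
         then scale (complex_of_real (eposic_eps m n h i (int j))) (basis_hom m (i + h - j))
         else 0))"

lemma ex_adjoint_eposic_kraus:
  "\<exists>S. is_adjoint (m + n - 2 * h) m (eposic_kraus m n h j) S"
proof -
  define r where "r = m + n - 2 * h"
  define g :: "nat \<Rightarrow> bipoly" where "g = (\<lambda>i. if int j \<in> eposic_B m n h i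
    then scale (complex_of_real (eposic_eps m n h i (int j))) (basis_hom m (i + h - j)) else 0)"
  define S where "S q = (\<Sum>i\<le>r. scale (inner_hom m (g i) q) (basis_hom r i))" for q
  have lscale: "Poly_Mapping.lookup (scale c p) x = c * Poly_Mapping.lookup p x" for c p x
    by (simp add: scale_def Poly_Mapping.map.rep_eq when_def)
  have sum_r: "inner_hom k p (\<Sum>i\<le>r. scale (c i) (b i)) = (\<Sum>i\<le>r. c i * inner_hom k p (b i))" for k p c b
    unfolding inner_hom_def sum_distrib_left
    by (subst sum.swap, rule sum.cong) (auto simp: lookup_sum lscale sum_distrib_left mult_ac)
  have cnj_ip: "inner_hom k p q = cnj (inner_hom k q p)" for k p q
    by (simp add: inner_hom_def mult_ac)
  have sum_l: "inner_hom k (\<Sum>i\<le>r. scale (c i) (b i)) p = (\<Sum>i\<le>r. cnj (c i) * inner_hom k (b i) p)" for k p c b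
    by (subst cnj_ip, subst sum_r) (simp add: cnj_ip[symmetric])
  have T: "eposic_kraus m n h j p = (\<Sum>i\<le>r. scale (inner_hom r (basis_hom r i) p) (g i))" for p
    by (simp add: eposic_kraus_def r_def g_def Let_def)
  have in_r: "S q \<in> hom_polys r" for q
    unfolding hom_polys_def S_def
    by (auto simp: lookup_sum lscale basis_hom_def lookup_single when_def elim!: sum.not_neutral_contains_not_neutral split: if_splits)
  have "inner_hom m (eposic_kraus m n h j p) q = inner_hom r p (S q)" for p q
    unfolding T S_def sum_l sum_r by (intro sum.cong refl) (simp add: cnj_ip[symmetric])
  then show ?thesis
    using in_r unfolding is_adjoint_def r_def[symmetric] by blast
qed

definition eposic_channel :: "nat \<Rightarrow> nat \<Rightarrow> nat \<Rightarrow> poly_op \<Rightarrow> poly_op" where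
  "eposic_channel m n h A =
     (\<lambda>q. \<Sum>j\<le>n. eposic_kraus m n h j
        (A (adjoint_op (m + n - 2 * h) m (eposic_kraus m n h j) q)))"

end

theory Submission
  imports "HOL-Analysis.Convex" Defs
begin

text \<open>For \<open>n = h = 1\<close> and \<open>m = r + 1\<close> the Kraus operators are multiplication by \<open>x\<^sub>1\<close> and by \<open>- x\<^sub>2\<close>, divided
  by \<open>sqrt (m + 1)\<close>. The output on a pure state \<open>w\<close> is a sum of two rank one operators, so its nonzero
  eigenvalues are those of the 2 by 2 Gram matrix of \<open>x\<^sub>1 w\<close> and \<open>x\<^sub>2 w\<close> divided by \<open>m + 1\<close>. Multiplication
  by a variable is adjoint to differentiation, so this Gram matrix is \<open>(1 + D) / (m + 1)\<close>, where \<open>D\<close>, the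
  Gram matrix of the partial derivatives of \<open>w\<close> (transposed), is positive semidefinite. Hence both
  eigenvalues are at least \<open>1 / (m + 1)\<close>; they add up to 1, so the entropy is at least the binary entropy
  at \<open>1 / (m + 1)\<close>. For a monomial in a single variable \<open>D\<close> has rank at most one and equality holds.\<close>

section \<open>Characteristic polynomials\<close>

lemma char_poly_four_block_upper_right_zero:
  fixes A :: "'a :: idom mat"
  assumes "A \<in> carrier_mat n n" "C \<in> carrier_mat k n" "D \<in> carrier_mat k k"
  shows "char_poly (four_block_mat A (0\<^sub>m n k) C D) = char_poly A * char_poly D"
proof -
  have eq: "char_poly_matrix (four_block_mat A (0\<^sub>m n k) C D) =
      four_block_mat (char_poly_matrix A) (0\<^sub>m n k) (map_mat (\<lambda>a. [:- a:]) C) (char_poly_matrix D)"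
    using assms by (intro eq_matI) (auto simp: char_poly_matrix_def)
  have "char_poly_matrix A \<in> carrier_mat n n" "char_poly_matrix D \<in> carrier_mat k k"
    "map_mat (\<lambda>a. [:- a:]) C \<in> carrier_mat k n"
    using assms by (auto simp: char_poly_matrix_def)
  then show ?thesis
    unfolding char_poly_def eq by (intro det_four_block_mat_upper_right_zero[OF _ refl])
qed

lemma char_poly_zero_mat: "char_poly (0\<^sub>m n n :: 'a :: comm_ring_1 mat) = [:0, 1:] ^ n"
proof -
  have "diag_mat (0\<^sub>m n n :: 'a mat) = replicate n 0"
    by (intro nth_equalityI) (auto simp: diag_mat_def)
  then show ?thesis
    by (subst char_poly_upper_triangular[where n = n]) (auto intro!: upper_triangularI)
qed

text \<open>This lets the spectrum of an output be read off a 2 by 2 matrix. \<open>X\<close> and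
  \<open>Y\<close> are similar and block triangular, with diagonal blocks \<open>U * V\<close>, zero
  and zero, \<open>V * U\<close>.\<close>

lemma char_poly_mult_swap:
  fixes U :: "'a :: idom mat"
  assumes U: "U \<in> carrier_mat n k" and V: "V \<in> carrier_mat k n"
  shows "char_poly (U * V) * [:0, 1:] ^ k = [:0, 1:] ^ n * char_poly (V * U)"
proof -
  \<comment> \<open>\<open>P\<close> conjugates \<open>Y\<close> into \<open>X\<close>, because both \<open>X * P\<close> and \<open>P * Y\<close> are the matrix with blocks
    \<open>U V\<close>, \<open>U V U\<close>, \<open>V\<close>, \<open>V U\<close>.\<close>
  define X where "X = four_block_mat (U * V) (0\<^sub>m n k) V (0\<^sub>m k k)"
  define Y where "Y = four_block_mat (0\<^sub>m n n) (0\<^sub>m n k) V (V * U)"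
  define P where "P = four_block_mat (1\<^sub>m n) U (0\<^sub>m k n) (1\<^sub>m k)"
  define Q where "Q = four_block_mat (1\<^sub>m n) (- U) (0\<^sub>m k n) (1\<^sub>m k)"
  have mU: "- U \<in> carrier_mat n k" using U by auto
  have one: "four_block_mat (1\<^sub>m n) (0\<^sub>m n k) (0\<^sub>m k n) (1\<^sub>m k) = (1\<^sub>m (n + k) :: 'a mat)"
    by (intro eq_matI) auto
  have UmU: "U + - U = 0\<^sub>m n k" "- U + U = 0\<^sub>m n k"
    using U by auto
  have neg0: "- 0\<^sub>m k k = (0\<^sub>m k k :: 'a mat)"
    by auto
  have PQ: "P * Q = 1\<^sub>m (n + k)" "Q * P = 1\<^sub>m (n + k)"
    unfolding P_def Q_def one[symmetric] using U
    by (auto simp: mult_four_block_mat[where ?nr1.0 = n and ?nr2.0 = k and ?n1.0 = n and ?n2.0 = k and ?nc1.0 = n and ?nc2.0 = k] UmU neg0)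
  have PY: "P * Y = four_block_mat (U * V) (U * (V * U)) V (V * U)"
    unfolding P_def Y_def using U V
    by (subst mult_four_block_mat[where ?nr1.0 = n and ?nr2.0 = k and ?n1.0 = n and ?n2.0 = k and ?nc1.0 = n and ?nc2.0 = k])
       auto
  have XP: "X * P = four_block_mat (U * V) (U * (V * U)) V (V * U)"
    unfolding P_def X_def using U V
    by (subst mult_four_block_mat[where ?nr1.0 = n and ?nr2.0 = k and ?n1.0 = n and ?n2.0 = k and ?nc1.0 = n and ?nc2.0 = k])
       auto
  have c: "X \<in> carrier_mat (n + k) (n + k)" "Y \<in> carrier_mat (n + k) (n + k)"
    "P \<in> carrier_mat (n + k) (n + k)" "Q \<in> carrier_mat (n + k) (n + k)"
    using U V by (auto simp: X_def Y_def P_def Q_def)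
  have "X = X * (P * Q)" using c PQ by simp
  also have "\<dots> = P * Y * Q" using c XP PY by (simp flip: assoc_mult_mat[OF c(1) c(3) c(4)])
  finally have "similar_mat X Y" using c PQ by (intro similar_matI[where P = P and Q = Q]) auto
  from char_poly_similar[OF this] show ?thesis
    unfolding X_def Y_def using U V
    by (simp add: char_poly_four_block_upper_right_zero char_poly_zero_mat)
qed

lemma det_mat_2:
  fixes A :: "'a :: comm_ring_1 mat"
  assumes "A \<in> carrier_mat 2 2"
  shows "det A = A $$ (0, 0) * A $$ (1, 1) - A $$ (0, 1) * A $$ (1, 0)"
proof -
  have "det A = (\<Sum>i<2. A $$ (i, 0) * cofactor A i 0)"
    using laplace_expansion_column[OF assms, of 0] by simp
  then show ?thesis
    using assms by (simp add: numeral_2_eq_2 cofactor_def det_single mat_delete_def)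
qed

lemma char_poly_2:
  fixes A :: "'a :: comm_ring_1 mat"
  assumes "A \<in> carrier_mat 2 2"
  shows "char_poly A = [:A $$ (0, 0) * A $$ (1, 1) - A $$ (0, 1) * A $$ (1, 0), - (A $$ (0, 0) + A $$ (1, 1)), 1:]"
  using assms unfolding char_poly_def
  by (subst det_mat_2) (auto simp: char_poly_matrix_def algebra_simps)

text \<open>The factor \<open>[:0, 1:] ^ k\<close> adds only the root \<open>0\<close>, where
  \<open>f\<close> vanishes. This disposes of the padding in
  \<open>char_poly_mult_swap\<close>.\<close>

lemma sum_mset_proots_mult_X:
  fixes p :: "'a :: idom poly" and f :: "'a \<Rightarrow> 'b :: comm_monoid_add"
  assumes "f 0 = 0" "p \<noteq> 0"
  shows "(\<Sum>e\<in>#proots ([:0, 1:] ^ k * p). f e) = (\<Sum>e\<in>#proots p. f e)"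
proof (induction k)
  case (Suc k)
  have "[:0, 1:] ^ k * p \<noteq> 0" using assms by simp
  moreover have "proots [:0, 1 :: 'a:] = {#0#}" using proots_linear_factor[of "0 :: 'a"] by simp
  ultimately show ?case using Suc assms by (simp add: proots_mult mult.assoc del: mult_pCons_left)
qed simp

text \<open>The matrix is \<open>U * V\<close>, where \<open>U\<close> has columns \<open>u\<close>,
  \<open>v\<close> and \<open>V\<close> is its conjugate transpose. So \<open>V * U\<close> is a
  Gram matrix of trace \<open>1\<close> and determinant \<open>x * (1 - x)\<close>, with eigenvalues
  \<open>x\<close> and \<open>1 - x\<close>.\<close>

lemma sum_mset_proots_rank_two:
  fixes u v :: "nat \<Rightarrow> complex" and f :: "complex \<Rightarrow> real" and x :: real and n :: nat
  defines "p \<equiv> \<Sum>a<n. (cmod (u a))\<^sup>2" and "q \<equiv> \<Sum>a<n. (cmod (v a))\<^sup>2"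
    and "z \<equiv> \<Sum>a<n. cnj (u a) * v a"
  assumes f0: "f 0 = 0"
    and tr: "p + q = 1" and det: "p * q - (cmod z)\<^sup>2 = x * (1 - x)"
  shows "(\<Sum>e\<in>#proots (char_poly (mat n n (\<lambda>(a, b). u a * cnj (u b) + v a * cnj (v b)))). f e)
    = f (complex_of_real x) + f (complex_of_real (1 - x))"
proof -
  define U where "U = mat n 2 (\<lambda>(a, j). if j = 0 then u a else v a)"
  define V where "V = mat 2 n (\<lambda>(j, b). if j = 0 then cnj (u b) else cnj (v b))"
  have U: "U \<in> carrier_mat n 2" and V: "V \<in> carrier_mat 2 n" by (auto simp: U_def V_def)
  have UV: "mat n n (\<lambda>(a, b). u a * cnj (u b) + v a * cnj (v b)) = U * V"
    by (intro eq_matI) (auto simp: U_def V_def scalar_prod_def numeral_2_eq_2)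
  have VU: "(V * U) $$ (0, 0) = complex_of_real p" "(V * U) $$ (1, 1) = complex_of_real q"
    "(V * U) $$ (0, 1) = z" "(V * U) $$ (1, 0) = cnj z"
    by (auto simp: U_def V_def scalar_prod_def p_def q_def z_def complex_norm_square atLeast0LessThan mult.commute
        simp del: of_real_power intro!: sum.cong)
  have "char_poly (V * U) = [:complex_of_real p * complex_of_real q - z * cnj z, - (complex_of_real p + complex_of_real q), 1:]"
    by (subst char_poly_2) (use U V VU in auto)
  also have "complex_of_real p * complex_of_real q - z * cnj z = complex_of_real (x * (1 - x))"
    by (simp only: det[symmetric] of_real_diff of_real_mult complex_norm_square)
  also have "complex_of_real p + complex_of_real q = 1"
    by (simp only: tr of_real_add[symmetric] of_real_1)
  also have "[:complex_of_real (x * (1 - x)), - 1, 1:] = [:- complex_of_real x, 1:] * [:- complex_of_real (1 - x), 1:]"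
    by (simp add: algebra_simps)
  finally have cp: "char_poly (V * U) = [:- complex_of_real x, 1:] * [:- complex_of_real (1 - x), 1:]" .
  have ne: "char_poly (U * V) \<noteq> 0"
    using degree_monic_char_poly[of "U * V" n] U V by auto
  have "(\<Sum>e\<in>#proots (char_poly (U * V)). f e) = (\<Sum>e\<in>#proots ([:0, 1:] ^ n * char_poly (V * U)). f e)"
    using sum_mset_proots_mult_X[where f = f and k = 2, OF f0 ne]
    by (simp only: char_poly_mult_swap[OF U V, symmetric] mult.commute[of "char_poly (U * V)"])
  also have "\<dots> = (\<Sum>e\<in>#proots (char_poly (V * U)). f e)"
    by (rule sum_mset_proots_mult_X[where f = f, OF f0]) (simp add: cp del: mult_pCons_left)
  also have "\<dots> = f (complex_of_real x) + f (complex_of_real (1 - x))"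
    unfolding cp by (subst proots_mult) (simp_all del: of_real_diff)
  finally show ?thesis unfolding UV .
qed

section \<open>Binary entropy\<close>

text \<open>Gibbs' inequality bounds the right side below by
  \<open>t * ln x + (1 - t) * ln (1 - x)\<close>. This exceeds the left side by
  \<open>(x - t) * (ln (1 - x) - ln x)\<close>, which is nonnegative as
  \<open>x \<le> 1 / 2\<close>.\<close>

lemma binary_entropy_mono:
  fixes t x :: real
  assumes "0 < t" "t \<le> x" "x \<le> 1 / 2"
  shows "x * ln x + (1 - x) * ln (1 - x) \<le> t * ln t + (1 - t) * ln (1 - t)"
proof -
  \<comment> \<open>Gibbs' inequality, term by term\<close>
  have gibbs: "a * ln b + a - b \<le> a * ln a" if "a > 0" "b > 0" for a b :: real
  proof -
    have "ln (b / a) \<le> b / a - 1" using that by (intro ln_le_minus_one) auto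
    then have "a * (ln b - ln a) \<le> a * (b / a - 1)" using that by (simp add: ln_div)
    then show ?thesis using that by (simp add: algebra_simps)
  qed
  have "0 \<le> (x - t) * (ln (1 - x) - ln x)"
    using assms by (intro mult_nonneg_nonneg) auto
  then show ?thesis using gibbs[of t x] gibbs[of "1 - t" "1 - x"] assms by (simp add: algebra_simps)
qed

section \<open>Coordinates\<close>

lemma lookup_scale: "Poly_Mapping.lookup (scale c p) x = c * Poly_Mapping.lookup p x"
  by (simp add: scale_def Poly_Mapping.map.rep_eq when_def)

lemma inner_hom_scale_right: "inner_hom k p (scale c q) = c * inner_hom k p q"
  by (simp add: inner_hom_def lookup_scale sum_distrib_left mult_ac)

lemma inner_hom_sum_right: "inner_hom k p (\<Sum>i\<in>I. q i) = (\<Sum>i\<in>I. inner_hom k p (q i))"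
  unfolding inner_hom_def by (subst sum.swap) (simp add: lookup_sum sum_distrib_left)

lemma cnj_inner_hom: "cnj (inner_hom k p q) = inner_hom k q p"
  by (simp add: inner_hom_def mult_ac)

lemma inner_basis_hom:
  assumes "l \<le> k"
  shows "inner_hom k (basis_hom k l) p =
    complex_of_real (sqrt (fact l * fact (k - l))) * Poly_Mapping.lookup p (l, k - l)"
proof -
  have "inner_hom k (basis_hom k l) p = fact l * fact (k - l) *
      complex_of_real (1 / sqrt (fact l * fact (k - l))) * Poly_Mapping.lookup p (l, k - l)"
    unfolding inner_hom_def using assms
    by (subst sum.remove[of _ l]) (auto simp: basis_hom_def lookup_single when_def intro!: sum.neutral)
  also have "fact l * fact (k - l) * complex_of_real (1 / sqrt (fact l * fact (k - l))) =
      complex_of_real (fact l * fact (k - l) / sqrt (fact l * fact (k - l)))"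
    by (simp del: real_sqrt_mult)
  also have "fact l * fact (k - l) / sqrt (fact l * fact (k - l)) = sqrt (fact l * fact (k - l))"
    by (rule real_div_sqrt) simp
  finally show ?thesis .
qed

lemma inner_basis_basis:
  assumes "l \<le> k" "l' \<le> k"
  shows "inner_hom k (basis_hom k l) (basis_hom k l') = of_bool (l = l')"
  using assms
  by (subst inner_basis_hom) (auto simp: basis_hom_def lookup_single when_def)

lemma basis_hom_in_hom_polys: "l \<le> k \<Longrightarrow> basis_hom k l \<in> hom_polys k"
  by (auto simp: hom_polys_def basis_hom_def lookup_single when_def split: if_splits)

lemma inner_hom_parseval:
  "inner_hom k p q = (\<Sum>l\<le>k. cnj (inner_hom k (basis_hom k l) p) * inner_hom k (basis_hom k l) q)"
proof -
  have sq: "complex_of_real (sqrt (fact l * fact j)) * complex_of_real (sqrt (fact l * fact j)) = fact l * fact j"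
    for l j
    unfolding of_real_mult[symmetric] by (subst real_sqrt_mult_self) simp
  show ?thesis
    unfolding inner_hom_def[of k p q]
  proof (intro sum.cong refl)
    fix l assume "l \<in> {..k}"
    then show "fact l * fact (k - l) * cnj (Poly_Mapping.lookup p (l, k - l)) * Poly_Mapping.lookup q (l, k - l) =
        cnj (inner_hom k (basis_hom k l) p) * inner_hom k (basis_hom k l) q"
      unfolding sq[symmetric] by (simp add: inner_basis_hom del: real_sqrt_mult)
  qed
qed

section \<open>Kraus operators\<close>

text \<open>For \<open>n = h = 1\<close> only \<open>s = j\<close> occurs in the sum
  \<open>eposic_eps\<close>. There \<open>R\<close> is \<open>m\<close>, \<open>F\<close> is
  \<open>fact r\<close>, and \<open>C\<close>, \<open>D\<close> are the binomials with upper index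
  \<open>r\<close>, \<open>m\<close>. The equation \<open>D * y = R * C\<close> is an absorption
  identity, with \<open>y = i + 1\<close> for \<open>j = 0\<close> and \<open>y = m - i\<close> for
  \<open>j = 1\<close>.\<close>

lemma eposic_normalization:
  fixes C D F R y :: real
  assumes "C > 0" "F > 0" "R > 0" "D * y = R * C" "y > 0"
  shows "sqrt (1 / (R + 1) * F * (R * F) / (C * D)) * (C / F) = sqrt (y / (R + 1))"
proof -
  have D: "D = R * C / y" using assms by (simp add: field_simps)
  have "1 / (R + 1) * F * (R * F) / (C * D) = y / (R + 1) * (F / C)\<^sup>2"
    unfolding D using assms(1-3,5) by (simp add: power2_eq_square)
  then have "sqrt (1 / (R + 1) * F * (R * F) / (C * D)) = sqrt (y / (R + 1)) * (F / C)"
    using assms by (simp only: real_sqrt_mult real_sqrt_abs) simp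
  then show ?thesis using assms by simp
qed

lemma eposic_c_1_1: "eposic_c (Suc r) 1 1 = 1 / (real (Suc r) + 1)"
  by (simp add: eposic_c_def divide_simps del: of_nat_Suc) (simp add: algebra_simps)

lemma eposic_eps_1_1_0:
  assumes "i \<le> r"
  shows "eposic_eps (Suc r) 1 1 i 0 = sqrt (real (Suc i) / (real r + 2))"
proof -
  have "real (Suc r choose Suc i) * real (Suc i) = real (Suc r) * real (r choose i)"
    using Suc_times_binomial_eq[of r i] by (metis of_nat_mult)
  from eposic_normalization[OF _ _ _ this, of "fact r"] show ?thesis
    using assms eposic_c_1_1[of r]
    by (simp add: eposic_eps_def Let_def binom_def nat_add_distrib algebra_simps)
qed

lemma eposic_eps_1_1_1:
  assumes "i \<le> r"
  shows "eposic_eps (Suc r) 1 1 i 1 = - sqrt (real (Suc r - i) / (real r + 2))"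
proof -
  have "real (Suc r choose i) * real (Suc r - i) = real (Suc r) * real (r choose i)"
    using binomial_absorb_comp[of "Suc r" i] by (metis of_nat_mult mult.commute diff_Suc_1)
  from eposic_normalization[OF _ _ _ this, of "fact r"] show ?thesis
    using assms eposic_c_1_1[of r]
    by (simp add: eposic_eps_def Let_def binom_def nat_add_distrib algebra_simps)
qed

text \<open>The coordinates of \<open>x\<^sub>1 w / sqrt (r + 2)\<close> and \<open>- x\<^sub>2 w / sqrt (r + 2)\<close> in degree \<open>r + 1\<close>, where \<open>c\<close>
  holds the coordinates of \<open>w\<close> in degree \<open>r\<close>. At \<open>a = r + 1\<close> the factor \<open>Suc r - a\<close> hides the junk
  value of \<open>c a\<close>.\<close>

definition x1_coords :: "nat \<Rightarrow> (nat \<Rightarrow> complex) \<Rightarrow> nat \<Rightarrow> complex" where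
  "x1_coords r c a = (if a = 0 then 0 else complex_of_real (sqrt (real a / (real r + 2))) * c (a - 1))"

definition x2_coords :: "nat \<Rightarrow> (nat \<Rightarrow> complex) \<Rightarrow> nat \<Rightarrow> complex" where
  "x2_coords r c a = - complex_of_real (sqrt (real (Suc r - a) / (real r + 2))) * c a"

text \<open>Multiplication by \<open>x\<^sub>1\<close> sends \<open>basis_hom r i\<close> to
  \<open>sqrt (i + 1)\<close> times \<open>basis_hom (r + 1) (i + 1)\<close>; dividing by
  \<open>sqrt (r + 2)\<close> gives these coefficients.\<close>

lemma eposic_kraus_1_1_0:
  "eposic_kraus (Suc r) 1 1 0 p =
    (\<Sum>i\<le>r. scale (inner_hom r (basis_hom r i) p)
      (scale (complex_of_real (sqrt (real (Suc i) / (real r + 2)))) (basis_hom (Suc r) (Suc i))))"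
  \<comment> \<open>For \<open>i \<le> r\<close> the set \<open>eposic_B (Suc r) 1 1 i\<close> is
    \<open>{0, 1}\<close>, so the zero branch never occurs.\<close>
  unfolding eposic_kraus_def Let_def
  by (intro sum.cong) (simp_all add: eposic_B_def eposic_eps_1_1_0[unfolded One_nat_def] del: of_nat_Suc)

text \<open>Multiplication by \<open>x\<^sub>2\<close> keeps the index \<open>i\<close> and brings
  the factor \<open>sqrt (r + 1 - i)\<close>; the sign is \<open>(-1) ^ s\<close> at
  \<open>s = 1\<close>.\<close>

lemma eposic_kraus_1_1_1:
  "eposic_kraus (Suc r) 1 1 1 p =
    (\<Sum>i\<le>r. scale (inner_hom r (basis_hom r i) p)
      (scale (complex_of_real (- sqrt (real (Suc r - i) / (real r + 2)))) (basis_hom (Suc r) i)))"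
  unfolding eposic_kraus_def Let_def
  by (intro sum.cong) (simp_all add: eposic_B_def eposic_eps_1_1_1[simplified])

lemma coords_eposic_kraus_1_1_0:
  assumes "a \<le> Suc r"
  shows "inner_hom (Suc r) (basis_hom (Suc r) a) (eposic_kraus (Suc r) 1 1 0 p) =
    x1_coords r (\<lambda>i. inner_hom r (basis_hom r i) p) a"
proof (cases a)
  case 0
  then show ?thesis
    by (simp add: eposic_kraus_1_1_0[simplified] x1_coords_def inner_hom_sum_right inner_hom_scale_right inner_basis_basis)
next
  case (Suc b)
  have "inner_hom (Suc r) (basis_hom (Suc r) a) (eposic_kraus (Suc r) 1 1 0 p) =
      (\<Sum>i\<le>r. if i = b then inner_hom r (basis_hom r i) p * complex_of_real (sqrt (real (Suc i) / (real r + 2))) else 0)"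
    unfolding eposic_kraus_1_1_0 inner_hom_sum_right inner_hom_scale_right
    using assms Suc by (intro sum.cong) (auto simp: inner_basis_basis)
  then show ?thesis using assms Suc by (simp add: x1_coords_def)
qed

lemma coords_eposic_kraus_1_1_1:
  assumes "a \<le> Suc r"
  shows "inner_hom (Suc r) (basis_hom (Suc r) a) (eposic_kraus (Suc r) 1 1 1 p) =
    x2_coords r (\<lambda>i. inner_hom r (basis_hom r i) p) a"
proof -
  have "inner_hom (Suc r) (basis_hom (Suc r) a) (eposic_kraus (Suc r) 1 1 1 p) =
      (\<Sum>i\<le>r. if i = a then - inner_hom r (basis_hom r i) p * complex_of_real (sqrt (real (Suc r - i) / (real r + 2))) else 0)"
    unfolding eposic_kraus_1_1_1 inner_hom_sum_right inner_hom_scale_right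
    using assms by (intro sum.cong) (auto simp: inner_basis_basis)
  then show ?thesis using assms by (auto simp: x2_coords_def)
qed

lemma eposic_kraus_scale: "eposic_kraus m n h j (scale c p) = scale c (eposic_kraus m n h j p)"
  by (intro poly_mapping_eqI)
     (simp add: eposic_kraus_def Let_def lookup_sum lookup_scale inner_hom_scale_right sum_distrib_left mult_ac)

text \<open>Pairing \<open>w\<close> with the adjoint of a Kraus operator \<open>T\<close> applied
  to a basis vector is pairing \<open>T w\<close> with that vector. Hence each \<open>T\<close>
  contributes the rank one operator of \<open>T w\<close>.\<close>

lemma op_matrix_eposic_channel_rank_one:
  assumes "w \<in> hom_polys (m + n - 2 * h)"
  shows "op_matrix m (eposic_channel m n h (rank_one (m + n - 2 * h) w w)) =
    mat (m + 1) (m + 1) (\<lambda>(a, b). \<Sum>j\<le>n. inner_hom m (basis_hom m a) (eposic_kraus m n h j w) *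
      cnj (inner_hom m (basis_hom m b) (eposic_kraus m n h j w)))"
  unfolding op_matrix_def
proof (intro eq_matI; clarsimp)
  fix a b assume "b < Suc m"
  have "is_adjoint (m + n - 2 * h) m (eposic_kraus m n h j) (adjoint_op (m + n - 2 * h) m (eposic_kraus m n h j))" for j
    unfolding adjoint_op_def using ex_adjoint_eposic_kraus by (rule someI_ex)
  then have "inner_hom (m + n - 2 * h) w (adjoint_op (m + n - 2 * h) m (eposic_kraus m n h j) (basis_hom m b)) =
      inner_hom m (eposic_kraus m n h j w) (basis_hom m b)" for j
    using assms basis_hom_in_hom_polys[of b m] \<open>b < Suc m\<close> unfolding is_adjoint_def by simp
  then show "inner_hom m (basis_hom m a) (eposic_channel m n h (rank_one (m + n - 2 * h) w w) (basis_hom m b)) =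
    (\<Sum>j\<le>n. inner_hom m (basis_hom m a) (eposic_kraus m n h j w) *
      cnj (inner_hom m (basis_hom m b) (eposic_kraus m n h j w)))"
    by (simp add: eposic_channel_def rank_one_def eposic_kraus_scale inner_hom_sum_right inner_hom_scale_right
        cnj_inner_hom mult.commute)
qed

section \<open>The Gram matrix\<close>

lemma sum_norm_x1_coords:
  "(\<Sum>a<r + 2. (cmod (x1_coords r c a))\<^sup>2) = (\<Sum>i\<le>r. real (Suc i) * (cmod (c i))\<^sup>2) / (real r + 2)"
  unfolding add_2_eq_Suc' sum.lessThan_Suc_shift[of _ "Suc r"] unfolding lessThan_Suc_atMost
  by (simp add: x1_coords_def norm_mult power_mult_distrib sum_divide_distrib del: of_nat_Suc)

lemma sum_norm_x2_coords:
  "(\<Sum>a<r + 2. (cmod (x2_coords r c a))\<^sup>2) = (\<Sum>i\<le>r. real (Suc r - i) * (cmod (c i))\<^sup>2) / (real r + 2)"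
  unfolding add_2_eq_Suc' sum.lessThan_Suc[of _ "Suc r"] lessThan_Suc_atMost
  by (simp add: x2_coords_def norm_mult power_mult_distrib sum_divide_distrib)

lemma sum_cnj_x1_x2_coords:
  "(\<Sum>a<r + 2. cnj (x1_coords r c a) * x2_coords r c a) =
    - (\<Sum>j<r. complex_of_real (sqrt (real (Suc j)) * sqrt (real (r - j))) * (cnj (c j) * c (Suc j))) / (real r + 2)"
proof -
  \<comment> \<open>At \<open>a = 0\<close> the first factor vanishes and at
    \<open>a = r + 1\<close> the second, which leaves \<open>a = j + 1\<close> with
    \<open>j < r\<close>.\<close>
  have "(\<Sum>a<r + 2. cnj (x1_coords r c a) * x2_coords r c a) =
      (\<Sum>j<r. cnj (x1_coords r c (Suc j)) * x2_coords r c (Suc j))"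
    by (simp add: sum.lessThan_Suc_shift[of _ "Suc r"] del: sum.lessThan_Suc)
       (simp add: x1_coords_def x2_coords_def)
  also have "\<dots> = (\<Sum>j<r. - (complex_of_real (sqrt (real (Suc j)) * sqrt (real (r - j))) * (cnj (c j) * c (Suc j))) / (real r + 2))"
  proof (intro sum.cong refl)
    fix j
    have "cnj (x1_coords r c (Suc j)) * x2_coords r c (Suc j) =
      - (complex_of_real (sqrt (real (Suc j) / (real r + 2)) * sqrt (real (r - j) / (real r + 2))) * (cnj (c j) * c (Suc j)))"
      by (simp add: x1_coords_def x2_coords_def del: of_nat_Suc real_sqrt_divide)
    also have "sqrt (real (Suc j) / (real r + 2)) * sqrt (real (r - j) / (real r + 2)) =
      sqrt (real (Suc j)) * sqrt (real (r - j)) / (real r + 2)"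
      by (simp add: real_sqrt_divide del: of_nat_Suc)
    finally show "cnj (x1_coords r c (Suc j)) * x2_coords r c (Suc j) =
      - (complex_of_real (sqrt (real (Suc j)) * sqrt (real (r - j))) * (cnj (c j) * c (Suc j))) / (real r + 2)"
      by simp
  qed
  finally show ?thesis by (simp add: sum_divide_distrib sum_negf)
qed

lemma gram_det_ge:
  fixes c :: "nat \<Rightarrow> complex"
  assumes "(\<Sum>i\<le>r. (cmod (c i))\<^sup>2) = 1"
  shows "(real r + 1) / (real r + 2)\<^sup>2 \<le>
    (\<Sum>a<r + 2. (cmod (x1_coords r c a))\<^sup>2) * (\<Sum>a<r + 2. (cmod (x2_coords r c a))\<^sup>2) -
    (cmod (\<Sum>a<r + 2. cnj (x1_coords r c a) * x2_coords r c a))\<^sup>2"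
proof -
  \<comment> \<open>\<open>P\<close>, \<open>Q\<close> and \<open>Z\<close> are, up to sign, the entries of the positive semidefinite matrix \<open>D\<close> with Gram
    matrix \<open>(1 + D) / (r + 2)\<close>; then \<open>det (1 + D) = 1 + tr D + det D\<close> with \<open>tr D = r\<close>.\<close>
  define P where "P = (\<Sum>j<r. (sqrt (real (Suc j)) * cmod (c (Suc j)))\<^sup>2)"
  define Q where "Q = (\<Sum>j<r. (sqrt (real (r - j)) * cmod (c j))\<^sup>2)"
  define Z where "Z = (\<Sum>j<r. complex_of_real (sqrt (real (Suc j)) * sqrt (real (r - j))) * (cnj (c j) * c (Suc j)))"
  have P: "P = (\<Sum>i\<le>r. real i * (cmod (c i))\<^sup>2)"
    unfolding lessThan_Suc_atMost[symmetric] sum.lessThan_Suc_shift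
    by (simp add: P_def power_mult_distrib)
  have Q: "Q = (\<Sum>i\<le>r. real (r - i) * (cmod (c i))\<^sup>2)"
    unfolding lessThan_Suc_atMost[symmetric] by (simp add: Q_def power_mult_distrib)
  \<comment> \<open>Euler's identity for homogeneous polynomials of degree \<open>r\<close>, in
    coordinates.\<close>
  have "P + Q = (\<Sum>i\<le>r. real r * (cmod (c i))\<^sup>2)"
    unfolding P Q sum.distrib[symmetric]
    by (intro sum.cong) (auto simp: of_nat_diff algebra_simps)
  also have "\<dots> = real r" using assms by (simp flip: sum_distrib_left)
  finally have PQ: "P + Q = real r" .
  \<comment> \<open>The added \<open>1\<close> is the commutator of differentiation with
    multiplication by the same variable.\<close>
  have p: "(\<Sum>i\<le>r. real (Suc i) * (cmod (c i))\<^sup>2) = 1 + P"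
    unfolding P assms[symmetric] by (simp add: algebra_simps sum.distrib)
  have q: "(\<Sum>i\<le>r. real (Suc r - i) * (cmod (c i))\<^sup>2) = 1 + Q"
    unfolding Q assms[symmetric] sum.distrib[symmetric]
    by (intro sum.cong) (auto simp: Suc_diff_le algebra_simps)
  \<comment> \<open>Prepares Cauchy-Schwarz, which says that \<open>det D\<close> is
    nonnegative.\<close>
  have "cmod Z \<le> (\<Sum>j<r. (sqrt (real (Suc j)) * cmod (c (Suc j))) * (sqrt (real (r - j)) * cmod (c j)))"
    unfolding Z_def by (intro order_trans[OF norm_sum] sum_mono) (simp add: norm_mult abs_mult mult_ac del: of_nat_Suc)
  then have "(cmod Z)\<^sup>2 \<le> P * Q"
    unfolding P_def Q_def
    by (intro order_trans[OF power_mono Cauchy_Schwarz_ineq_sum]) auto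
  then have "real r + 1 \<le> (1 + P) * (1 + Q) - (cmod Z)\<^sup>2"
    using PQ by (simp add: algebra_simps)
  then have "(real r + 1) / (real r + 2)\<^sup>2 \<le> ((1 + P) * (1 + Q) - (cmod Z)\<^sup>2) / (real r + 2)\<^sup>2"
    by (intro divide_right_mono) auto
  also have "cmod (complex_of_real (real r + 2)) = real r + 2"
    unfolding norm_of_real by simp
  then have "((1 + P) * (1 + Q) - (cmod Z)\<^sup>2) / (real r + 2)\<^sup>2 =
      (1 + P) / (real r + 2) * ((1 + Q) / (real r + 2)) - (cmod (- Z / complex_of_real (real r + 2)))\<^sup>2"
    by (simp add: norm_divide power_divide diff_divide_distrib power2_eq_square)
  finally show ?thesis
    unfolding sum_norm_x1_coords sum_norm_x2_coords sum_cnj_x1_x2_coords p q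
    by (simp add: Z_def)
qed

text \<open>The channel preserves the trace: the weights \<open>i + 1\<close> and
  \<open>r + 1 - i\<close> of a coordinate add up to \<open>r + 2\<close>.\<close>

lemma gram_trace:
  fixes c :: "nat \<Rightarrow> complex"
  assumes "(\<Sum>i\<le>r. (cmod (c i))\<^sup>2) = 1"
  shows "(\<Sum>a<r + 2. (cmod (x1_coords r c a))\<^sup>2) + (\<Sum>a<r + 2. (cmod (x2_coords r c a))\<^sup>2) = 1"
proof -
  have "(\<Sum>i\<le>r. real (Suc i) * (cmod (c i))\<^sup>2) + (\<Sum>i\<le>r. real (Suc r - i) * (cmod (c i))\<^sup>2) =
      (\<Sum>i\<le>r. (real r + 2) * (cmod (c i))\<^sup>2)"
    unfolding sum.distrib[symmetric] by (intro sum.cong) (auto simp: of_nat_diff algebra_simps)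
  also have "\<dots> = real r + 2" using assms by (simp flip: sum_distrib_left)
  finally show ?thesis
    unfolding sum_norm_x1_coords sum_norm_x2_coords by (simp flip: add_divide_distrib)
qed

section \<open>Output entropies\<close>

lemma unit_vector_coords:
  assumes "w \<in> unit_vectors r"
  shows "(\<Sum>i\<le>r. (cmod (inner_hom r (basis_hom r i) w))\<^sup>2) = 1"
proof -
  have "complex_of_real (\<Sum>i\<le>r. (cmod (inner_hom r (basis_hom r i) w))\<^sup>2) = inner_hom r w w"
    by (subst inner_hom_parseval[of r w w]) (simp add: complex_norm_square mult.commute del: of_real_power)
  then show ?thesis using assms unfolding unit_vectors_def by (metis (mono_tags) mem_Collect_eq of_real_eq_1_iff)
qed

text \<open>The Gram matrix has trace \<open>1\<close>, so any \<open>x\<close> for which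
  \<open>x * (1 - x)\<close> is its determinant yields the eigenvalues \<open>x\<close> and
  \<open>1 - x\<close>.\<close>

lemma entropy_eposic_channel_1_1:
  fixes x :: real
  assumes w: "w \<in> unit_vectors r"
    and c: "c = (\<lambda>i. inner_hom r (basis_hom r i) w)"
    and x: "(\<Sum>a<r + 2. (cmod (x1_coords r c a))\<^sup>2) * (\<Sum>a<r + 2. (cmod (x2_coords r c a))\<^sup>2) -
      (cmod (\<Sum>a<r + 2. cnj (x1_coords r c a) * x2_coords r c a))\<^sup>2 = x * (1 - x)"
  shows "entropy (Suc r) (eposic_channel (Suc r) 1 1 (rank_one r w w)) =
    - (x * log 2 x + (1 - x) * log 2 (1 - x))"
proof -
  have "op_matrix (Suc r) (eposic_channel (Suc r) 1 1 (rank_one r w w)) =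
      mat (r + 2) (r + 2) (\<lambda>(a, b). x1_coords r c a * cnj (x1_coords r c b) + x2_coords r c a * cnj (x2_coords r c b))"
    using w op_matrix_eposic_channel_rank_one[of w "Suc r" 1 1]
      coords_eposic_kraus_1_1_0[of _ r w] coords_eposic_kraus_1_1_1[of _ r w]
    by (auto simp: c unit_vectors_def intro!: eq_matI)
  then show ?thesis
    using sum_mset_proots_rank_two[where f = "\<lambda>e. Re e * log 2 (Re e)", OF _ gram_trace x]
      unit_vector_coords[OF w]
    by (simp add: entropy_def c)
qed

lemma entropy_eposic_channel_1_1_ge:
  assumes w: "w \<in> unit_vectors r"
  shows "- (1 / (real r + 2) * log 2 (1 / (real r + 2)) +
      (real r + 1) / (real r + 2) * log 2 ((real r + 1) / (real r + 2)))
    \<le> entropy (Suc r) (eposic_channel (Suc r) 1 1 (rank_one r w w))"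
proof -
  define c where "c = (\<lambda>i. inner_hom r (basis_hom r i) w)"
  define p where "p = (\<Sum>a<r + 2. (cmod (x1_coords r c a))\<^sup>2)"
  define q where "q = (\<Sum>a<r + 2. (cmod (x2_coords r c a))\<^sup>2)"
  define d where "d = p * q - (cmod (\<Sum>a<r + 2. cnj (x1_coords r c a) * x2_coords r c a))\<^sup>2"
  \<comment> \<open>The smaller eigenvalue, as a root of \<open>x * (1 - x) = d\<close>; the root is
    real because \<open>4 * d \<le> 4 * p * q \<le> 1\<close>.\<close>
  define x where "x = (1 - sqrt (1 - 4 * d)) / 2"
  define t where "t = 1 / (real r + 2)"
  have unit: "(\<Sum>i\<le>r. (cmod (c i))\<^sup>2) = 1" unfolding c_def by (rule unit_vector_coords[OF w])
  have "p + q = 1" unfolding p_def q_def by (rule gram_trace[OF unit])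
  then have q: "q = 1 - p" by simp
  have "d \<le> p * q" by (simp add: d_def)
  moreover have "0 \<le> (1 - 2 * p)\<^sup>2" by simp
  ultimately have "4 * d \<le> 1" unfolding q by (simp add: power2_eq_square algebra_simps)
  then have x: "x \<le> 1 / 2" "x * (1 - x) = d"
    by (auto simp: x_def field_simps)
  have t: "0 < t" "t \<le> 1 / 2" "1 - t = (real r + 1) / (real r + 2)" by (auto simp: t_def field_simps)
  have "t * (1 - t) \<le> d"
    using gram_det_ge[OF unit] unfolding t(3) by (simp add: d_def p_def q_def t_def power2_eq_square)
  \<comment> \<open>As \<open>x\<close> and \<open>t\<close> are at most \<open>1 / 2\<close>, the
    second factor is nonnegative, and it vanishes only for \<open>x = t = 1 / 2\<close>.\<close>
  then have "0 \<le> (x - t) * (1 - x - t)" unfolding x(2)[symmetric] by (simp add: algebra_simps)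
  then have "t \<le> x" using x t by (auto simp: zero_le_mult_iff)
  from binary_entropy_mono[OF t(1) this x(1)]
  have "(x * ln x + (1 - x) * ln (1 - x)) / ln 2 \<le> (t * ln t + (1 - t) * ln (1 - t)) / ln 2"
    by (intro divide_right_mono) auto
  then have "x * log 2 x + (1 - x) * log 2 (1 - x) \<le> t * log 2 t + (1 - t) * log 2 (1 - t)"
    by (simp add: log_def add_divide_distrib)
  moreover have "entropy (Suc r) (eposic_channel (Suc r) 1 1 (rank_one r w w)) =
      - (x * log 2 x + (1 - x) * log 2 (1 - x))"
    using x(2) by (intro entropy_eposic_channel_1_1[OF w c_def]) (simp add: d_def p_def q_def)
  ultimately show ?thesis unfolding t(3) by (simp add: t_def)
qed

text \<open>The minimizer is the normalized power of \<open>x\<^sub>2\<close>. Its products with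
  \<open>x\<^sub>1\<close> and \<open>x\<^sub>2\<close> are multiples of distinct monomials, so the
  Gram matrix is diagonal with entries \<open>1 / (r + 2)\<close> and
  \<open>(r + 1) / (r + 2)\<close>.\<close>

lemma entropy_eposic_channel_1_1_basis_hom:
  "basis_hom r 0 \<in> unit_vectors r"
  "entropy (Suc r) (eposic_channel (Suc r) 1 1 (rank_one r (basis_hom r 0) (basis_hom r 0))) =
    - (1 / (real r + 2) * log 2 (1 / (real r + 2)) +
      (real r + 1) / (real r + 2) * log 2 ((real r + 1) / (real r + 2)))"
proof -
  show w: "basis_hom r 0 \<in> unit_vectors r"
    by (simp add: unit_vectors_def basis_hom_in_hom_polys inner_basis_basis)
  define c where "c = (\<lambda>i. inner_hom r (basis_hom r i) (basis_hom r 0))"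
  have c: "c i = of_bool (i = 0)" if "i \<le> r" for i
    using that by (simp add: c_def inner_basis_basis)
  have z: "(\<Sum>a<r + 2. cnj (x1_coords r c a) * x2_coords r c a) = 0"
    unfolding sum_cnj_x1_x2_coords by (simp add: c)
  have p: "(\<Sum>i\<le>r. real (Suc i) * (cmod (c i))\<^sup>2) = 1"
    by (subst sum.remove[of _ 0]) (auto simp: c intro!: sum.neutral)
  have q: "(\<Sum>i\<le>r. real (Suc r - i) * (cmod (c i))\<^sup>2) = real r + 1"
    by (subst sum.remove[of _ 0]) (auto simp: c intro!: sum.neutral)
  have t: "1 - 1 / (real r + 2) = (real r + 1) / (real r + 2)" by (simp add: field_simps)
  show "entropy (Suc r) (eposic_channel (Suc r) 1 1 (rank_one r (basis_hom r 0) (basis_hom r 0))) =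
    - (1 / (real r + 2) * log 2 (1 / (real r + 2)) +
      (real r + 1) / (real r + 2) * log 2 ((real r + 1) / (real r + 2)))"
    using entropy_eposic_channel_1_1[OF w c_def, of "1 / (real r + 2)"]
    unfolding z sum_norm_x1_coords sum_norm_x2_coords p q t by simp
qed

theorem mainTheorem3:
  fixes m :: nat
  assumes "m \<ge> 1"
  shows "min_output_entropy (m - 1) m (eposic_channel m 1 1) =
           - (1 / (real m + 1) * log 2 (1 / (real m + 1))
              + real m / (real m + 1) * log 2 (real m / (real m + 1)))
         \<and> min_output_entropy (m - 1) m (eposic_channel m 1 1)
             \<in> output_entropies (m - 1) m (eposic_channel m 1 1)
         \<and> (\<forall>s \<in> output_entropies (m - 1) m (eposic_channel m 1 1).
              min_output_entropy (m - 1) m (eposic_channel m 1 1) \<le> s)"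
proof -
  define r where "r = m - 1"
  have m: "m = Suc r" "real m = real r + 1" "real r + 1 + 1 = real r + 2" using assms by (auto simp: r_def)
  define E where "E = - (1 / (real m + 1) * log 2 (1 / (real m + 1))
              + real m / (real m + 1) * log 2 (real m / (real m + 1)))"
  have mem: "E \<in> output_entropies (m - 1) m (eposic_channel m 1 1)"
    unfolding output_entropies_def E_def m(2,3) r_def[symmetric] unfolding m(1)
    by (intro CollectI exI[of _ "basis_hom r 0"] conjI entropy_eposic_channel_1_1_basis_hom
        entropy_eposic_channel_1_1_basis_hom(2)[symmetric])
  have least: "\<forall>s \<in> output_entropies (m - 1) m (eposic_channel m 1 1). E \<le> s"
    using entropy_eposic_channel_1_1_ge[of _ r]
    unfolding output_entropies_def E_def m(2,3) r_def[symmetric] unfolding m(1) by auto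
  have "min_output_entropy (m - 1) m (eposic_channel m 1 1) = E"
    unfolding min_output_entropy_def using mem least by (intro Least_equality) auto
  with mem least show ?thesis unfolding E_def by simp
qed

end
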